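(* Let $n\ge1$, $1\le K\le 2^n$, let $\mathbf c$ be a control register of $n$ qubits, $\mathbf t$ a target register, and $U$ a unitary on the target register. Write $K=2^{k_1}+2^{k_2}+\cdots+2^{k_p}$ with $k_1>k_2>\cdots>k_p\ge 0$. Then the low-pass controlled unitary gate $$C_{\le K}^{\mathbf c}U_{\mathbf t}=\sum_{i<K}|i\rangle\langle i|_{\mathbf c}\otimes U_{\mathbf t}+\sum_{i\ge K}|i\rangle\langle i|_{\mathbf c}\otimes I_{\mathbf t}$$ can be expressed as a product of $p=\mathcal O(\log K)$ multi-controlled unitaries, namely $$C_{\le K}^{\mathbf c}U_{\mathbf t}=\prod_{j=1}^{p}C_{c_j(K)}^{\mathbf c}U_{\mathbf t},\qquad c_j(K)=\sum_{i=1}^{j-1}2^{k_i-k_j},$$ where $c_j(K)$ is read as a bitstring of length $n-k_j$ controlling the first $n-k_j$ qubits of $\mathbf c$.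
   Context: Computational basis states of the control register are identified with the integers $0,\dots,2^n-1$ via binary expansion (first qubit most significant). For a bitstring $b$ of length $m\le n$, the multi-controlled unitary $C_b^{\mathbf c}U_{\mathbf t}$ applies $U$ to the target register if the first $m$ control qubits are in state $|b\rangle$, and acts as the identity otherwise: $$C_b^{\mathbf c}U_{\mathbf t}=\big(I-|b\rangle\langle b|\otimes I^{\otimes (n-m)}\big)_{\mathbf c}\otimes I_{\mathbf t}+\big(|b\rangle\langle b|\otimes I^{\otimes(n-m)}\big)_{\mathbf c}\otimes U_{\mathbf t}$$ (for $m=0$, it is the uncontrolled $U$). The bitstring $c_j(K)$ is the binary representation of the integer, padded with leading zeros to length $n-k_j$. The bound $\mathcal O(\log K)$ is asymptotic as $K\to\infty$. *)

theory Defs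
  imports
    "Jordan_Normal_Form.Schur_Decomposition"
    "HOL-Library.Landau_Symbols"
begin

section \<open>Operators on registers\<close>

text \<open>Row index \<open>i * dim_row B + k\<close> of the product stands for the pair \<open>(i, k)\<close>, so the left
  factor is the most significant one.\<close>

definition kron :: "complex mat \<Rightarrow> complex mat \<Rightarrow> complex mat" (infixr "\<otimes>\<^sub>k" 72) where
  "A \<otimes>\<^sub>k B = mat (dim_row A * dim_row B) (dim_col A * dim_col B)
     (\<lambda>(i, j). A $$ (i div dim_row B, j div dim_col B) * B $$ (i mod dim_row B, j mod dim_col B))"

definition outer_prod :: "complex vec \<Rightarrow> complex vec \<Rightarrow> complex mat" where
  "outer_prod v w = mat (dim_vec v) (dim_vec w) (\<lambda>(i, j). v $ i * conjugate (w $ j))"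

definition unitary_mat :: "complex mat \<Rightarrow> bool" where
  "unitary_mat U \<longleftrightarrow> square_mat U \<and> mat_adjoint U * U = 1\<^sub>m (dim_row U)
     \<and> U * mat_adjoint U = 1\<^sub>m (dim_row U)"

definition mat_prod :: "nat \<Rightarrow> complex mat list \<Rightarrow> complex mat" where
  "mat_prod N As = foldr (*) As (1\<^sub>m N)"

section \<open>Bitstrings\<close>

text \<open>Bitstrings are lists of Booleans with the most significant bit first.\<close>

definition nat_of_bitstring :: "bool list \<Rightarrow> nat" where
  "nat_of_bitstring b = horner_sum of_bool 2 (rev b)"

text \<open>For \<open>x \<ge> 2 ^ l\<close> the leading bits of \<open>x\<close> would be lost.\<close>

definition bitstring :: "nat \<Rightarrow> nat \<Rightarrow> bool list" where
  "bitstring l x = rev (map (bit x) [0..<l])"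

definition ket_bits :: "bool list \<Rightarrow> complex vec" where
  "ket_bits b = unit_vec (2 ^ length b) (nat_of_bitstring b)"

section \<open>Controlled gates\<close>

text \<open>In both gates \<open>n\<close> is the number of control qubits, and the control register is the left
  tensor factor.\<close>

definition multi_controlled :: "nat \<Rightarrow> bool list \<Rightarrow> complex mat \<Rightarrow> complex mat" where
  "multi_controlled n b U =
     (let P = outer_prod (ket_bits b) (ket_bits b) \<otimes>\<^sub>k 1\<^sub>m (2 ^ (n - length b))
      in (1\<^sub>m (2 ^ n) - P) \<otimes>\<^sub>k 1\<^sub>m (dim_row U) + P \<otimes>\<^sub>k U)"

definition low_pass_controlled :: "nat \<Rightarrow> nat \<Rightarrow> complex mat \<Rightarrow> complex mat" where
  "low_pass_controlled n K U =
     (let d = dim_row U; M = module_mat TYPE(complex) (2 ^ n * d) (2 ^ n * d);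
          P = (\<lambda>i. outer_prod (unit_vec (2 ^ n) i) (unit_vec (2 ^ n) i))
      in (\<Oplus>\<^bsub>M\<^esub> i \<in> {0..<K}. P i \<otimes>\<^sub>k U) + (\<Oplus>\<^bsub>M\<^esub> i \<in> {K..<2 ^ n}. P i \<otimes>\<^sub>k 1\<^sub>m d))"

section \<open>Binary expansions\<close>

text \<open>The exponents are \<open>k 1 > \<dots> > k p\<close>; other values of \<open>k\<close> are irrelevant.\<close>

definition binary_expansion :: "nat \<Rightarrow> nat \<Rightarrow> (nat \<Rightarrow> nat) \<Rightarrow> bool" where
  "binary_expansion K p k \<longleftrightarrow>
     (\<forall>i j. 1 \<le> i \<and> i < j \<and> j \<le> p \<longrightarrow> k i > k j) \<and> K = (\<Sum>j=1..p. 2 ^ k j)"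

definition control_value :: "(nat \<Rightarrow> nat) \<Rightarrow> nat \<Rightarrow> nat" where
  "control_value k j = (\<Sum>i=1..<j. 2 ^ (k i - k j))"

end

theory Submission
  imports Defs
begin

text \<open>Put \<open>S\<^sub>j = 2 ^ k 1 + \<dots> + 2 ^ k (j - 1)\<close>. All these exponents exceed \<open>k j\<close>, so
  \<open>S\<^sub>j = control_value k j * 2 ^ k j\<close>, and the control condition of the \<open>j\<close>-th gate selects exactly
  the basis states \<open>i\<close> with \<open>S\<^sub>j \<le> i < S\<^sub>j + 2 ^ k j\<close>. These intervals partition
  \<open>{..<K}\<close>, and gates that apply \<open>U\<close> on disjoint sets of basis states compose to the gate for the union.
  As the exponents decrease strictly, \<open>k 1 \<ge> p - 1\<close> and hence \<open>2 ^ (p - 1) \<le> K\<close>.\<close>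

section \<open>Gates controlled by a set of basis states\<close>

text \<open>A block-diagonal matrix with blocks of size \<open>d\<close>: index \<open>i\<close>
  stands for the control state \<open>i div d\<close> and the target state \<open>i mod d\<close>,
  as in \<open>kron\<close>. Both kinds of controlled gate are brought to this form, so that only
  sets of control states remain to be compared.\<close>

definition set_controlled :: "nat \<Rightarrow> nat set \<Rightarrow> complex mat \<Rightarrow> complex mat" where
  "set_controlled N S U = (let d = dim_row U in
     mat (N * d) (N * d) (\<lambda>(i, j).
       if i div d \<in> S then (if i div d = j div d then U $$ (i mod d, j mod d) else 0)
       else of_bool (i = j)))"

lemma set_controlled_carrier [simp]:
  "U \<in> carrier_mat d d \<Longrightarrow> set_controlled N S U \<in> carrier_mat (N * d) (N * d)"
  by (auto simp: set_controlled_def Let_def)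

lemma set_controlled_index:
  assumes "U \<in> carrier_mat d d" "i < N * d" "j < N * d"
  shows "set_controlled N S U $$ (i, j) =
    (if i div d \<in> S then (if i div d = j div d then U $$ (i mod d, j mod d) else 0)
     else of_bool (i = j))"
  using assms by (auto simp: set_controlled_def Let_def)

lemma set_controlled_empty:
  "U \<in> carrier_mat d d \<Longrightarrow> set_controlled N {} U = 1\<^sub>m (N * d)"
  by (rule eq_matI) (auto simp: set_controlled_def Let_def)

text \<open>Multiplication goes block by block, and by disjointness at least one of the two factors
  is the identity on each block.\<close>

lemma set_controlled_mult:
  assumes U: "U \<in> carrier_mat d d" and disj: "S \<inter> T = {}"
  shows "set_controlled N S U * set_controlled N T U = set_controlled N (S \<union> T) U"
    (is "?A * ?B = ?C")
proof (rule eq_matI)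
  have A: "?A \<in> carrier_mat (N * d) (N * d)" and B: "?B \<in> carrier_mat (N * d) (N * d)"
    and C: "?C \<in> carrier_mat (N * d) (N * d)"
    using U by simp_all
  show "dim_row (?A * ?B) = dim_row ?C" "dim_col (?A * ?B) = dim_col ?C"
    using A B C by auto
  fix i j assume "i < dim_row ?C" "j < dim_col ?C"
  then have ij: "i < N * d" "j < N * d" using C by auto
  have prod: "(?A * ?B) $$ (i, j) = (\<Sum>l<N * d. ?A $$ (i, l) * ?B $$ (l, j))"
    using A B ij by (simp add: scalar_prod_def lessThan_atLeast0)
  show "(?A * ?B) $$ (i, j) = ?C $$ (i, j)"
  proof (cases "i div d \<in> S")
    case False
    \<comment> \<open>Row \<open>i\<close> of \<open>?A\<close> is a row of the identity matrix, so
      only \<open>l = i\<close> survives.\<close>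
    have "(\<Sum>l<N * d. ?A $$ (i, l) * ?B $$ (l, j)) = (\<Sum>l<N * d. if l = i then ?B $$ (l, j) else 0)"
      using False ij by (intro sum.cong) (auto simp: set_controlled_index[OF U])
    also have "\<dots> = ?B $$ (i, j)" using ij by simp
    finally show ?thesis using False ij prod by (simp add: set_controlled_index[OF U])
  next
    case True
    then have iT: "i div d \<notin> T" using disj by auto
    \<comment> \<open>Row \<open>i\<close> of \<open>?A\<close> vanishes outside the columns
      \<open>l\<close> of its own block. That block belongs to a state outside \<open>T\<close>, so
      row \<open>l\<close> of \<open>?B\<close> is a row of the identity matrix.\<close>
    have "(\<Sum>l<N * d. ?A $$ (i, l) * ?B $$ (l, j)) = (\<Sum>l<N * d. if l = j then ?A $$ (i, l) else 0)"
      using True iT ij by (intro sum.cong) (auto simp: set_controlled_index[OF U])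
    also have "\<dots> = ?A $$ (i, j)" using ij by simp
    finally show ?thesis using True ij prod by (simp add: set_controlled_index[OF U])
  qed
qed

lemma mat_prod_set_controlled:
  assumes U: "U \<in> carrier_mat d d" and "distinct js" "disjoint_family_on S (set js)"
  shows "mat_prod (N * d) (map (\<lambda>j. set_controlled N (S j) U) js) =
    set_controlled N (\<Union>j\<in>set js. S j) U"
  using assms(2,3)
proof (induction js)
  case Nil
  then show ?case using set_controlled_empty[OF U] by (simp add: mat_prod_def)
next
  case (Cons a js)
  \<comment> \<open>Distinctness enters here: \<open>a\<close> differs from every index in
    \<open>js\<close>.\<close>
  have "S a \<inter> (\<Union>j\<in>set js. S j) = {}"
    using Cons.prems by (auto simp: disjoint_family_on_def)
  moreover have "disjoint_family_on S (set js)"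
    using Cons.prems by (auto simp: disjoint_family_on_def)
  ultimately show ?case
    using Cons set_controlled_mult[OF U] by (simp add: mat_prod_def)
qed

section \<open>Bitstrings and multi-controlled gates\<close>

lemma length_bitstring: "length (bitstring l x) = l"
  by (simp add: bitstring_def)

lemma nat_of_bitstring_bitstring: "x < 2 ^ l \<Longrightarrow> nat_of_bitstring (bitstring l x) = x"
  by (simp add: nat_of_bitstring_def bitstring_def horner_sum_bit_eq_take_bit take_bit_nat_eq_self)

text \<open>With the first qubit most significant, the value of the first \<open>length b\<close>
  bits of a basis state is its quotient by \<open>2 ^ (n - length b)\<close>.\<close>

lemma multi_controlled_eq_set_controlled:
  assumes U: "U \<in> carrier_mat d d" and b: "length b \<le> n"
  shows "multi_controlled n b U =
    set_controlled (2 ^ n) {i. i div 2 ^ (n - length b) = nat_of_bitstring b} U"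
proof -
  let ?m = "n - length b"
  define P where "P = outer_prod (ket_bits b) (ket_bits b) \<otimes>\<^sub>k 1\<^sub>m (2 ^ ?m)"
  have N: "(2::nat) ^ n = 2 ^ length b * 2 ^ ?m" using b by (simp flip: power_add)
  have P: "P = mat (2 ^ n) (2 ^ n)
    (\<lambda>(i, j). of_bool (i = j \<and> i div 2 ^ ?m = nat_of_bitstring b))"
  proof (rule eq_matI)
    fix i j assume "i < dim_row (mat (2 ^ n) (2 ^ n)
        (\<lambda>(i, j). of_bool (i = j \<and> i div 2 ^ ?m = nat_of_bitstring b) :: complex))"
      "j < dim_col (mat (2 ^ n) (2 ^ n)
        (\<lambda>(i, j). of_bool (i = j \<and> i div 2 ^ ?m = nat_of_bitstring b) :: complex))"
    then have ij: "i < 2 ^ n" "j < 2 ^ n" by auto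
    then have "i div 2 ^ ?m < 2 ^ length b" "j div 2 ^ ?m < 2 ^ length b"
      by (simp_all add: N less_mult_imp_div_less)
    \<comment> \<open>The outer product compares quotients and the identity factor compares
      remainders; agreement of both puts the entry on the diagonal.\<close>
    moreover have "i = j" if "i div 2 ^ ?m = j div 2 ^ ?m" "i mod 2 ^ ?m = j mod 2 ^ ?m"
      using that by (metis div_mult_mod_eq)
    ultimately show "P $$ (i, j) = mat (2 ^ n) (2 ^ n)
        (\<lambda>(i, j). of_bool (i = j \<and> i div 2 ^ ?m = nat_of_bitstring b)) $$ (i, j)"
      using ij by (auto simp: P_def kron_def outer_prod_def ket_bits_def unit_vec_def N)
  qed (auto simp: P_def kron_def outer_prod_def ket_bits_def N)
  show ?thesis
  proof (rule eq_matI)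
    fix i j assume "i < dim_row (set_controlled (2 ^ n) {i. i div 2 ^ ?m = nat_of_bitstring b} U)"
      "j < dim_col (set_controlled (2 ^ n) {i. i div 2 ^ ?m = nat_of_bitstring b} U)"
    then have ij: "i < 2 ^ n * d" "j < 2 ^ n * d" using U by (auto simp: set_controlled_def Let_def)
    \<comment> \<open>An index in range excludes \<open>d = 0\<close>, so remainders modulo
      \<open>d\<close> are valid indices into \<open>U\<close>.\<close>
    then have "d > 0" by (cases d) auto
    moreover have "i div d < 2 ^ n" "j div d < 2 ^ n"
      using ij by (simp_all add: less_mult_imp_div_less)
    moreover have "i = j" if "i div d = j div d" "i mod d = j mod d"
      using that by (metis div_mult_mod_eq)
    ultimately show "multi_controlled n b U $$ (i, j) =
        set_controlled (2 ^ n) {i. i div 2 ^ ?m = nat_of_bitstring b} U $$ (i, j)"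
      using U ij unfolding multi_controlled_def Let_def P_def[symmetric] P set_controlled_index[OF U ij]
      by (auto simp: kron_def)
  qed (use U in \<open>unfold multi_controlled_def Let_def P_def[symmetric] P, auto simp: kron_def set_controlled_def Let_def\<close>)
qed

section \<open>The low-pass gate as a sum of matrices\<close>

lemma finsum_module_mat:
  assumes "finite I" "\<And>i. i \<in> I \<Longrightarrow> f i \<in> carrier_mat r c"
  shows "(\<Oplus>\<^bsub>module_mat TYPE('a :: comm_ring_1) r c\<^esub> i \<in> I. f i) =
    mat r c (\<lambda>(a, b). \<Sum>i\<in>I. f i $$ (a, b))"
  using assms
proof (induction I rule: finite_induct)
  case empty
  interpret abelian_group "module_mat TYPE('a) r c" by (rule abelian_group_mat)
  show ?case by (auto simp: module_mat_simps)
next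
  case (insert x I)
  interpret abelian_group "module_mat TYPE('a) r c" by (rule abelian_group_mat)
  have "(\<Oplus>\<^bsub>module_mat TYPE('a) r c\<^esub> i \<in> insert x I. f i) =
     f x + (\<Oplus>\<^bsub>module_mat TYPE('a) r c\<^esub> i \<in> I. f i)"
    using insert by (subst finsum_insert) (auto simp: module_mat_simps)
  also have "\<dots> = mat r c (\<lambda>(a, b). \<Sum>i\<in>insert x I. f i $$ (a, b))"
    using insert by (intro eq_matI) auto
  finally show ?case .
qed

text \<open>Row \<open>a\<close> receives a contribution only from the projector onto
  \<open>i = a div d\<close>, and this index belongs to the first sum exactly when
  \<open>a div d < K\<close>.\<close>

lemma low_pass_controlled_eq_set_controlled:
  assumes U: "U \<in> carrier_mat d d" and K: "K \<le> 2 ^ n"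
  shows "low_pass_controlled n K U = set_controlled (2 ^ n) {..<K} U"
proof (rule eq_matI)
  let ?P = "\<lambda>i. outer_prod (unit_vec (2 ^ n) i) (unit_vec (2 ^ n) i)"
  have car: "?P i \<otimes>\<^sub>k V \<in> carrier_mat (2 ^ n * d) (2 ^ n * d)" if "V \<in> carrier_mat d d" for i V
    using that by (auto simp: kron_def outer_prod_def)
  have eq: "low_pass_controlled n K U =
      mat (2 ^ n * d) (2 ^ n * d) (\<lambda>(a, b). \<Sum>i=0..<K. (?P i \<otimes>\<^sub>k U) $$ (a, b)) +
      mat (2 ^ n * d) (2 ^ n * d) (\<lambda>(a, b). \<Sum>i=K..<2 ^ n. (?P i \<otimes>\<^sub>k 1\<^sub>m d) $$ (a, b))"
    using U by (simp add: low_pass_controlled_def Let_def finsum_module_mat car)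
  show "dim_row (low_pass_controlled n K U) = dim_row (set_controlled (2 ^ n) {..<K} U)"
    "dim_col (low_pass_controlled n K U) = dim_col (set_controlled (2 ^ n) {..<K} U)"
    using U by (auto simp: eq set_controlled_def Let_def)
  fix a b assume "a < dim_row (set_controlled (2 ^ n) {..<K} U)"
    "b < dim_col (set_controlled (2 ^ n) {..<K} U)"
  then have ab: "a < 2 ^ n * d" "b < 2 ^ n * d" using U by (auto simp: set_controlled_def Let_def)
  then have d: "d > 0" by (cases d) auto
  have lt: "a div d < 2 ^ n" "b div d < 2 ^ n"
    using ab by (simp_all add: less_mult_imp_div_less)
  have entry: "(?P i \<otimes>\<^sub>k V) $$ (a, b) = (if i = a div d then
      if a div d = b div d then V $$ (a mod d, b mod d) else 0 else 0)"
    if "V \<in> carrier_mat d d" for i V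
    using that ab lt by (auto simp: kron_def outer_prod_def unit_vec_def)
  have "a = b" if "a div d = b div d" "a mod d = b mod d"
    using that by (metis div_mult_mod_eq)
  then show "low_pass_controlled n K U $$ (a, b) = set_controlled (2 ^ n) {..<K} U $$ (a, b)"
    using U ab lt d by (auto simp: eq entry set_controlled_index[OF U])
qed

section \<open>Binary expansions\<close>

text \<open>Strong induction through \<open>K div 2\<close>: doubling raises every exponent by one,
  and an odd \<open>K\<close> gets a further last term \<open>2 ^ 0\<close>.\<close>

lemma binary_expansion_exists: "\<exists>p k. binary_expansion K p k"
proof (induction K rule: less_induct)
  case (less K)
  show ?case
  proof (cases "K = 0")
    case True
    then have "binary_expansion K 0 (\<lambda>_. 0)" by (simp add: binary_expansion_def)
    then show ?thesis by blast
  next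
    case False
    then obtain p k where pk: "binary_expansion (K div 2) p k" using less[of "K div 2"] by auto
    then have half: "K div 2 * 2 = (\<Sum>j=1..p. 2 ^ Suc (k j))"
      by (simp add: binary_expansion_def sum_distrib_left mult.commute[of _ 2])
    show ?thesis
    proof (cases "even K")
      case True
      then have "K div 2 * 2 = K" by simp
      then have "binary_expansion K p (\<lambda>j. Suc (k j))"
        using pk unfolding half by (simp add: binary_expansion_def del: power_Suc)
      then show ?thesis by blast
    next
      case False
      \<comment> \<open>The shifted exponents are positive, so the new exponent 0 at index
        \<open>Suc p\<close> keeps the sequence strictly decreasing.\<close>
      let ?k = "\<lambda>j. if j \<le> p then Suc (k j) else 0"
      have "(\<Sum>j=1..Suc p. 2 ^ ?k j) = (\<Sum>j=1..p. 2 ^ Suc (k j)) + (1 :: nat)"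
        by simp
      also have "\<dots> = K" using False half by (metis odd_two_times_div_two_succ mult.commute)
      finally have "binary_expansion K (Suc p) ?k"
        using pk by (auto simp: binary_expansion_def)
      then show ?thesis by blast
    qed
  qed
qed

text \<open>Counting back from the last exponent, each step adds at least one, so after
  \<open>p - 1\<close> steps \<open>k 1\<close> is at least \<open>p - 1\<close>.\<close>

lemma binary_expansion_length:
  assumes "binary_expansion K p k" "1 \<le> p"
  shows "2 ^ (p - 1) \<le> K"
proof -
  have "i < p \<Longrightarrow> i \<le> k (p - i)" for i
  proof (induction i)
    case (Suc i)
    then have "k (p - i) < k (p - Suc i)"
      using assms(1)[unfolded binary_expansion_def, THEN conjunct1, rule_format, of "p - Suc i" "p - i"]
      by linarith
    then show ?case using Suc by auto
  qed simp
  from this[of "p - 1"] have "p - 1 \<le> k 1" using assms(2) by simp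
  then have "2 ^ (p - 1) \<le> (2 :: nat) ^ k 1" by simp
  also have "\<dots> \<le> K"
    using assms by (auto simp: binary_expansion_def intro!: member_le_sum)
  finally show ?thesis .
qed

text \<open>Since \<open>k i > k j\<close> for \<open>i < j\<close>, the subtraction in
  \<open>control_value\<close> is never truncated.\<close>

lemma control_value_mult:
  assumes "binary_expansion K p k" "j \<in> {1..p}"
  shows "control_value k j * 2 ^ k j = (\<Sum>i=1..<j. 2 ^ k i)"
  unfolding control_value_def sum_distrib_right
proof (rule sum.cong)
  fix i assume "i \<in> {1..<j}"
  then have "k j < k i" using assms by (auto simp: binary_expansion_def)
  then show "2 ^ (k i - k j) * 2 ^ k j = (2 :: nat) ^ k i" by (simp flip: power_add)
qed simp

text \<open>The left side is the sum of the first \<open>j\<close> terms of the expansion. With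
  \<open>K \<le> 2 ^ n\<close> this makes the control value fit into \<open>n - k j\<close>
  bits.\<close>

lemma control_value_bound:
  assumes "binary_expansion K p k" "j \<in> {1..p}"
  shows "(control_value k j + 1) * 2 ^ k j \<le> K"
proof -
  have "(control_value k j + 1) * 2 ^ k j = (\<Sum>i=1..<Suc j. 2 ^ k i)"
    using assms by (simp add: control_value_mult algebra_simps)
  also have "\<dots> \<le> K"
    using assms by (auto simp: binary_expansion_def simp del: sum.op_ivl_Suc intro!: sum_mono2)
  finally show ?thesis .
qed

text \<open>The numbers with quotient \<open>c\<close> by \<open>2 ^ k j\<close> form an interval of
  length \<open>2 ^ k j\<close> starting at \<open>c * 2 ^ k j\<close>, which for the control value
  is a partial sum of the expansion.\<close>

lemma control_set_eq:
  assumes "binary_expansion K p k" "j \<in> {1..p}"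
  shows "{i. i div 2 ^ k j = control_value k j} = {(\<Sum>i=1..<j. 2 ^ k i)..<(\<Sum>i=1..<Suc j. 2 ^ k i)}"
proof -
  have "i div 2 ^ k j = control_value k j \<longleftrightarrow>
      control_value k j * 2 ^ k j \<le> i \<and> i < control_value k j * 2 ^ k j + 2 ^ k j" for i
  proof -
    have "i div 2 ^ k j = control_value k j \<longleftrightarrow>
        control_value k j \<le> i div 2 ^ k j \<and> i div 2 ^ k j < Suc (control_value k j)"
      by linarith
    also have "\<dots> \<longleftrightarrow> control_value k j * 2 ^ k j \<le> i \<and> i < Suc (control_value k j) * 2 ^ k j"
      by (simp only: less_eq_div_iff_mult_less_eq div_less_iff_less_mult zero_less_power zero_less_numeral)
    finally show ?thesis by (simp add: add.commute)
  qed
  moreover have "(\<Sum>i=1..<Suc j. 2 ^ k i) = (\<Sum>i=1..<j. 2 ^ k i) + (2 :: nat) ^ k j"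
    using assms by simp
  ultimately show ?thesis
    unfolding control_value_mult[OF assms] by (simp only: set_eq_iff mem_Collect_eq atLeastLessThan_iff simp_thms)
qed

section \<open>Consecutive intervals and the product formula\<close>

lemma UN_consecutive_intervals:
  fixes s :: "nat \<Rightarrow> 'a :: linorder"
  assumes "mono s"
  shows "(\<Union>j\<in>{1..p}. {s j..<s (Suc j)}) = {s 1..<s (Suc p)}"
proof (induction p)
  case (Suc p)
  have "s 1 \<le> s (Suc p)" "s (Suc p) \<le> s (Suc (Suc p))"
    using assms by (auto intro: monoD)
  then have "{s 1..<s (Suc (Suc p))} = {s 1..<s (Suc p)} \<union> {s (Suc p)..<s (Suc (Suc p))}"
    by (simp add: ivl_disj_un)
  then show ?case using Suc by (auto simp: atLeastAtMostSuc_conv)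
qed simp

lemma disjoint_consecutive_intervals:
  fixes s :: "nat \<Rightarrow> 'a :: linorder"
  assumes "mono s"
  shows "disjoint_family_on (\<lambda>j. {s j..<s (Suc j)}) J"
proof -
  have "{s i..<s (Suc i)} \<inter> {s j..<s (Suc j)} = {}" if "i < j" for i j
    using monoD[OF assms, of "Suc i" j] that by auto
  then show ?thesis
    unfolding disjoint_family_on_def by (metis Int_commute linorder_neqE_nat)
qed

lemma low_pass_controlled_eq_mat_prod:
  assumes U: "U \<in> carrier_mat d d" and K: "K \<le> 2 ^ n" and bin: "binary_expansion K p k"
    and fits: "\<And>j. j \<in> {1..p} \<Longrightarrow> k j \<le> n \<and> control_value k j < 2 ^ (n - k j)"
  shows "low_pass_controlled n K U = mat_prod (2 ^ n * d)
    (map (\<lambda>j. multi_controlled n (bitstring (n - k j) (control_value k j)) U) [1..<p + 1])"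
proof -
  define s :: "nat \<Rightarrow> nat" where "s j = (\<Sum>i=1..<j. 2 ^ k i)" for j
  have s: "mono s" unfolding s_def by (auto intro!: monoI sum_mono2)
  \<comment> \<open>By \<open>fits\<close>, encoding loses no leading bits, and
    \<open>n - (n - k j) = k j\<close> gives the divisor \<open>2 ^ k j\<close> of the control
    set.\<close>
  have "multi_controlled n (bitstring (n - k j) (control_value k j)) U =
      set_controlled (2 ^ n) {s j..<s (Suc j)} U" if "j \<in> {1..p}" for j
    using fits[OF that] control_set_eq[OF bin that]
    by (simp add: multi_controlled_eq_set_controlled[OF U] nat_of_bitstring_bitstring length_bitstring
        s_def del: sum.op_ivl_Suc)
  then have "map (\<lambda>j. multi_controlled n (bitstring (n - k j) (control_value k j)) U) [1..<p + 1] =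
      map (\<lambda>j. set_controlled (2 ^ n) {s j..<s (Suc j)} U) [1..<p + 1]"
    by auto
  moreover have "(\<Union>j\<in>set [1..<p + 1]. {s j..<s (Suc j)}) = {..<K}"
  proof -
    \<comment> \<open>The partial sums start with the empty sum and end with the full
      expansion.\<close>
    have "s 1 = 0" "s (Suc p) = K"
      using bin by (simp_all add: s_def binary_expansion_def atLeastLessThanSuc_atLeastAtMost del: sum.op_ivl_Suc)
    moreover have "set [1..<p + 1] = {1..p}" by auto
    ultimately show ?thesis using UN_consecutive_intervals[OF s, of p] by (simp add: lessThan_atLeast0)
  qed
  ultimately show ?thesis
    using low_pass_controlled_eq_set_controlled[OF U K]
      mat_prod_set_controlled[OF U distinct_upt disjoint_consecutive_intervals[OF s], of "2 ^ n" 1 "p + 1"]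
    by (simp only:)
qed

lemma binary_expansion_length_bigo:
  fixes p :: "nat \<Rightarrow> nat"
  assumes "\<forall>L\<ge>1. \<exists>k. binary_expansion L (p L) k"
  shows "(\<lambda>L. real (p L)) \<in> O(\<lambda>L. ln (real L))"
proof (rule bigoI)
  \<comment> \<open>For \<open>L \<ge> 2\<close>, both \<open>p L - 1\<close> and 1 are at most
    \<open>ln L / ln 2\<close>, which gives the factor 2. At \<open>L = 1\<close> the logarithm
    vanishes although one term is present.\<close>
  show "\<forall>\<^sub>F L in sequentially. norm (real (p L)) \<le> (2 / ln 2) * norm (ln (real L))"
    using eventually_ge_at_top[of "2 :: nat"]
  proof eventually_elim
    case (elim L)
    then have ln2: "ln 2 \<le> ln (real L)" by simp
    show ?case
    proof (cases "p L = 0")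
      case False
      obtain k where "binary_expansion L (p L) k" using assms elim by force
      then have "2 ^ (p L - 1) \<le> L" using False by (intro binary_expansion_length) auto
      then have "real (2 ^ (p L - 1)) \<le> real L" by (simp only: of_nat_le_iff)
      then have "ln (2 ^ (p L - 1)) \<le> ln (real L)"
        using elim by (simp del: ln_le_cancel_iff add: ln_mono)
      then have "(real (p L) - 1) * ln 2 \<le> ln (real L)"
        using False by (simp add: ln_realpow of_nat_diff)
      then have "real (p L) * ln 2 \<le> 2 * ln (real L)" using ln2 by (simp add: algebra_simps)
      then show ?thesis using elim by (simp add: field_simps)
    qed simp
  qed
qed

text \<open>Existence of an expansion keeps the second conjunct from being vacuous; its range
  conditions ensure that \<open>n - k j\<close> is a true difference and that each bitstring encodes
  its control value faithfully. The asymptotic bound concerns a length function on all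
  \<open>L\<close>, as \<open>K\<close> itself is fixed.\<close>

theorem theorem1:
  fixes n K d :: nat and U :: "complex mat"
  assumes "n \<ge> 1" and "1 \<le> K" and "K \<le> 2 ^ n"
    and "U \<in> carrier_mat d d" and "unitary_mat U"
  shows "(\<exists>p k. binary_expansion K p k) \<and>
    (\<forall>p k. binary_expansion K p k \<longrightarrow>
       (\<forall>j\<in>{1..p}. k j \<le> n \<and> control_value k j < 2 ^ (n - k j)) \<and>
       low_pass_controlled n K U =
         mat_prod (2 ^ n * d)
           (map (\<lambda>j. multi_controlled n (bitstring (n - k j) (control_value k j)) U) [1..<p+1])) \<and>
    (\<forall>p :: nat \<Rightarrow> nat. (\<forall>L\<ge>1. \<exists>k. binary_expansion L (p L) k) \<longrightarrow>
       (\<lambda>L. real (p L)) \<in> O(\<lambda>L. ln (real L)))"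
proof (intro conjI allI impI)
  show "\<exists>p k. binary_expansion K p k" by (rule binary_expansion_exists)
next
  fix p k assume bin: "binary_expansion K p k"
  have fits: "k j \<le> n \<and> control_value k j < 2 ^ (n - k j)" if "j \<in> {1..p}" for j
  proof -
    have le: "(control_value k j + 1) * 2 ^ k j \<le> 2 ^ n"
      using control_value_bound[OF bin that] assms(3) by linarith
    \<comment> \<open>The factor \<open>control_value k j + 1\<close> is at least 1.\<close>
    have "(2 :: nat) ^ k j \<le> 2 ^ n" by (rule order.trans[OF _ le]) simp
    then have "k j \<le> n" by simp
    then have "(2 :: nat) ^ n = 2 ^ (n - k j) * 2 ^ k j" by (simp flip: power_add)
    then have "control_value k j + 1 \<le> 2 ^ (n - k j)"
      using le by (metis mult_le_cancel2 zero_less_numeral zero_less_power)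
    then show ?thesis using \<open>k j \<le> n\<close> by simp
  qed
  then show "\<forall>j\<in>{1..p}. k j \<le> n \<and> control_value k j < 2 ^ (n - k j)" by blast
  show "low_pass_controlled n K U = mat_prod (2 ^ n * d)
      (map (\<lambda>j. multi_controlled n (bitstring (n - k j) (control_value k j)) U) [1..<p + 1])"
    using assms(4,3) bin fits by (rule low_pass_controlled_eq_mat_prod)
next
  fix p :: "nat \<Rightarrow> nat" assume "\<forall>L\<ge>1. \<exists>k. binary_expansion L (p L) k"
  then show "(\<lambda>L. real (p L)) \<in> O(\<lambda>L. ln (real L))" by (rule binary_expansion_length_bigo)
qed

end
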